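(* Let $u\colon\mathbb{R}^3\to\mathbb{O}$ be continuous and let both $u$ and its octonion Fourier transform $U_{\mathrm{OFT}}$ be Lebesgue integrable on $\mathbb{R}^3$. Then for all $\mathbf{x}=(x_1,x_2,x_3)\in\mathbb{R}^3$ we have $$u(\mathbf{x})=\int_{\mathbb{R}^3}U_{\mathrm{OFT}}(\mathbf{f})\,e^{\mathbf{e}_4 2\pi f_3x_3}\,e^{\mathbf{e}_2 2\pi f_2x_2}\,e^{\mathbf{e}_1 2\pi f_1x_1}\,d\mathbf{f},$$ where the multiplication is performed from left to right.
   Context: $\mathbb{O}$ denotes the real algebra of octonions with basis $1,\mathbf{e}_1,\dots,\mathbf{e}_7$: an octonion is a pair $(q_0,q_1)$ of quaternions (quaternion units $\mathbf{e}_1,\mathbf{e}_2,\mathbf{e}_3$ with $\mathbf{e}_1\mathbf{e}_2=\mathbf{e}_3$), with product $(q_0,q_1)\cdot(p_0,p_1)=(q_0p_0-p_1^*q_1,\;p_1q_0+q_1p_0^* )$, where $^*$ is quaternion conjugation, and $\mathbf{e}_4=(0,1)$, $\mathbf{e}_5=(0,\mathbf{e}_1)$, $\mathbf{e}_6=(0,\mathbf{e}_2)$, $\mathbf{e}_7=(0,\mathbf{e}_3)$. The product is neither commutative nor associative; products without brackets are evaluated from left to right, i.e. $abcd=((ab)c)d$. For an imaginary unit $\mathbf{e}_k$ and $\alpha\in\mathbb{R}$, $e^{\mathbf{e}_k\alpha}=\cos\alpha+\mathbf{e}_k\sin\alpha$. Integrals of octonion-valued functions are taken componentwise. The octonion Fourier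 transform (OFT) of a Lebesgue integrable $u\colon\mathbb{R}^3\to\mathbb{O}$ is $$U_{\mathrm{OFT}}(\mathbf{f})=\int_{\mathbb{R}^3}u(\mathbf{x})\,e^{-\mathbf{e}_1 2\pi f_1x_1}\,e^{-\mathbf{e}_2 2\pi f_2x_2}\,e^{-\mathbf{e}_4 2\pi f_3x_3}\,d\mathbf{x},\qquad \mathbf{f}=(f_1,f_2,f_3)\in\mathbb{R}^3,$$ with multiplication from left to right. *)

theory Defs
  imports "HOL-Analysis.Analysis"
begin

text \<open>
  Quaternions and octonions are nested products over the reals. Addition, scalar multiplication,
  norm and topology are those of the library's product types (the Euclidean ones). Hence the
  Bochner integral of an integrable octonion-valued function is its componentwise integral.
\<close>

type_synonym quaternion = "real \<times> real \<times> real \<times> real"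
type_synonym octonion = "quaternion \<times> quaternion"

fun quat_mult :: "quaternion \<Rightarrow> quaternion \<Rightarrow> quaternion"  (infixl "*\<^sub>H" 70) where
  "(a0, a1, a2, a3) *\<^sub>H (b0, b1, b2, b3) =
     (a0 * b0 - a1 * b1 - a2 * b2 - a3 * b3,
      a0 * b1 + a1 * b0 + a2 * b3 - a3 * b2,
      a0 * b2 - a1 * b3 + a2 * b0 + a3 * b1,
      a0 * b3 + a1 * b2 - a2 * b1 + a3 * b0)"

fun quat_conj :: "quaternion \<Rightarrow> quaternion" where
  "quat_conj (a0, a1, a2, a3) = (a0, - a1, - a2, - a3)"

fun oct_mult :: "octonion \<Rightarrow> octonion \<Rightarrow> octonion"  (infixl "*\<^sub>O" 70) where
  "(q0, q1) *\<^sub>O (p0, p1) =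
     (q0 *\<^sub>H p0 - quat_conj p1 *\<^sub>H q1, p1 *\<^sub>H q0 + q1 *\<^sub>H quat_conj p0)"

definition oct_one :: octonion where "oct_one = ((1, 0, 0, 0), (0, 0, 0, 0))"
definition oct_e1 :: octonion where "oct_e1 = ((0, 1, 0, 0), (0, 0, 0, 0))"
definition oct_e2 :: octonion where "oct_e2 = ((0, 0, 1, 0), (0, 0, 0, 0))"
definition oct_e3 :: octonion where "oct_e3 = ((0, 0, 0, 1), (0, 0, 0, 0))"
definition oct_e4 :: octonion where "oct_e4 = ((0, 0, 0, 0), (1, 0, 0, 0))"
definition oct_e5 :: octonion where "oct_e5 = ((0, 0, 0, 0), (0, 1, 0, 0))"
definition oct_e6 :: octonion where "oct_e6 = ((0, 0, 0, 0), (0, 0, 1, 0))"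
definition oct_e7 :: octonion where "oct_e7 = ((0, 0, 0, 0), (0, 0, 0, 1))"

lemmas oct_unit_defs = oct_one_def oct_e1_def oct_e2_def oct_e3_def
  oct_e4_def oct_e5_def oct_e6_def oct_e7_def

lemma oct_unit_products:
  "oct_e1 *\<^sub>O oct_e2 = oct_e3"  "oct_e2 *\<^sub>O oct_e1 = - oct_e3"
  "oct_e1 *\<^sub>O oct_e4 = oct_e5"  "oct_e2 *\<^sub>O oct_e4 = oct_e6"  "oct_e3 *\<^sub>O oct_e4 = oct_e7"
  "oct_e1 *\<^sub>O oct_e1 = - oct_one"  "oct_e2 *\<^sub>O oct_e2 = - oct_one"
  "oct_e4 *\<^sub>O oct_e4 = - oct_one"
  by (simp_all add: oct_unit_defs zero_prod_def)

lemma oct_one_mult: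
  fixes x :: octonion
  shows "oct_one *\<^sub>O x = x" "x *\<^sub>O oct_one = x"
proof -
  obtain a b c d a' b' c' d' where "x = ((a, b, c, d), (a', b', c', d'))"
    by (metis prod.exhaust)
  then show "oct_one *\<^sub>O x = x" "x *\<^sub>O oct_one = x"
    by (simp_all add: oct_one_def zero_prod_def)
qed

text \<open>Intended only for imaginary units \<open>e\<close>.\<close>

definition oct_exp :: "octonion \<Rightarrow> real \<Rightarrow> octonion" where
  "oct_exp e \<alpha> = cos \<alpha> *\<^sub>R oct_one + sin \<alpha> *\<^sub>R e"

text \<open>Since \<open>*\<^sub>O\<close> associates to the left, the products below are evaluated from left to right.\<close>

definition OFT :: "(real ^ 3 \<Rightarrow> octonion) \<Rightarrow> real ^ 3 \<Rightarrow> octonion" where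
  "OFT u f = (LINT x|lebesgue. u x
     *\<^sub>O oct_exp oct_e1 (- (2 * pi * f $ 1 * x $ 1))
     *\<^sub>O oct_exp oct_e2 (- (2 * pi * f $ 2 * x $ 2))
     *\<^sub>O oct_exp oct_e4 (- (2 * pi * f $ 3 * x $ 3)))"

end

theory Submission
  imports Defs "HOL-Probability.Characteristic_Functions"
begin

text \<open>
  The proof is the classical Gaussian regularisation, arranged so that right alternativity,
  \<open>(v e) e = v (e e)\<close>, takes the place of associativity.
  Insert \<open>exp (- pi \<bar>f\<bar>\<^sup>2 / n\<^sup>2)\<close> into the inversion integral. By dominated convergence the
  regularised integrals tend to the inversion integral, because the transform is integrable and
  multiplication by the exponentials preserves the norm (\<open>norm_oct_mult_exp\<close>). On the other hand
  Fubini's theorem allows the frequency integral to be carried out first, for each fixed value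
  \<open>u y\<close>. There the order of the factors in the inverse kernel pays off: \<open>u y\<close> is multiplied from the right
  by exponentials in \<open>e\<^sub>1\<close>, \<open>e\<^sub>2\<close>, \<open>e\<^sub>4\<close>, \<open>e\<^sub>4\<close>, \<open>e\<^sub>2\<close>, \<open>e\<^sub>1\<close>. The innermost pair merges by right
  alternativity, the octonions being an alternative algebra (\<open>oct_mult_exp_exp\<close>). Its sine part is
  odd in the third frequency and integrates to zero, so the pair contributes the real factor
  \<open>cos (2 pi f\<^sub>3 (x\<^sub>3 - y\<^sub>3))\<close>. The next pair is then adjacent and the step repeats, until only a product of
  cosines is left (\<open>gauss_kernel\<close>).

  Hence the regularised integral is the convolution of \<open>u\<close> with the scaled Gaussian
  \<open>n\<^sup>3 exp (- pi n\<^sup>2 \<bar>x - y\<bar>\<^sup>2)\<close>, which tends to \<open>u x\<close> at every point by continuity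
  (\<open>gauss_approximate_identity\<close>). Uniqueness of limits gives the theorem.
\<close>

section \<open>Right multiplication by octonion exponentials\<close>

lemma bounded_bilinear_oct_mult: "bounded_bilinear (*\<^sub>O)"
proof -
  have "bilinear (*\<^sub>O)"
    unfolding bilinear_def
    by (auto intro!: linearI simp: algebra_simps)
  then show ?thesis
    by (simp add: bilinear_conv_bounded_bilinear)
qed

lemma oct_mult_add_left: "(v + w) *\<^sub>O a = v *\<^sub>O a + w *\<^sub>O a"
  by (rule bounded_bilinear.add_left[OF bounded_bilinear_oct_mult])

lemma oct_mult_scaleR_left: "(c *\<^sub>R v) *\<^sub>O a = c *\<^sub>R (v *\<^sub>O a)"
  by (rule bounded_bilinear.scaleR_left[OF bounded_bilinear_oct_mult])

lemma oct_mult_exp: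
  "v *\<^sub>O oct_exp e t = cos t *\<^sub>R v + sin t *\<^sub>R (v *\<^sub>O e)"
  by (simp add: oct_exp_def bounded_bilinear.add_right[OF bounded_bilinear_oct_mult]
      bounded_bilinear.scaleR_right[OF bounded_bilinear_oct_mult] oct_one_mult)

text \<open>
  Right multiplication by such an octonion squares to minus the identity and is a skew isometry, so
  its exponentials behave like plane rotations. For \<open>e\<^sub>1\<close>, \<open>e\<^sub>2\<close>, \<open>e\<^sub>4\<close> this carries the whole argument.
\<close>

definition imaginary_unit :: "octonion \<Rightarrow> bool" where
  "imaginary_unit e \<longleftrightarrow> e \<bullet> oct_one = 0 \<and> norm e = 1"

lemma imaginary_unit_axes [simp]:
  "imaginary_unit oct_e1" "imaginary_unit oct_e2" "imaginary_unit oct_e4"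
  by (simp_all add: imaginary_unit_def oct_unit_defs norm_eq_sqrt_inner)

text \<open>
  The first equation is the instance of right alternativity, \<open>(v e) e = v (e e)\<close>, on which the
  inversion formula rests. General associativity fails, but every rebracketing in the proof is of
  this kind.
\<close>

lemma oct_mult_imaginary:
  fixes v e :: octonion
  assumes "e \<bullet> oct_one = 0"
  shows "v *\<^sub>O e *\<^sub>O e = - (e \<bullet> e) *\<^sub>R v"
    and "v \<bullet> (v *\<^sub>O e) = 0"
    and "(v *\<^sub>O e) \<bullet> (v *\<^sub>O e) = (e \<bullet> e) * (v \<bullet> v)"
proof -
  obtain a b c d a' b' c' d' where v: "v = ((a, b, c, d), (a', b', c', d'))"
    by (metis prod.exhaust)
  obtain r p q s r' p' q' s' where e: "e = ((r, p, q, s), (r', p', q', s'))"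
    by (metis prod.exhaust)
  have "r = 0" using assms by (simp add: e oct_one_def)
  then show "v *\<^sub>O e *\<^sub>O e = - (e \<bullet> e) *\<^sub>R v" "v \<bullet> (v *\<^sub>O e) = 0"
    "(v *\<^sub>O e) \<bullet> (v *\<^sub>O e) = (e \<bullet> e) * (v \<bullet> v)"
    by (simp_all add: v e algebra_simps)
qed

text \<open>
  When the inverse kernel is applied to the forward one, the two inner \<open>e\<^sub>4\<close>-factors are adjacent
  and merge. The \<open>e\<^sub>2\<close>- and \<open>e\<^sub>1\<close>-factors become adjacent only once what stands between them
  is real.
\<close>

lemma oct_mult_exp_exp:
  assumes "imaginary_unit e"
  shows "v *\<^sub>O oct_exp e s *\<^sub>O oct_exp e t = v *\<^sub>O oct_exp e (s + t)"
proof -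
  have "v *\<^sub>O e *\<^sub>O e = - v"
    using assms by (simp add: imaginary_unit_def oct_mult_imaginary(1) norm_eq_1)
  then show ?thesis
    by (simp add: oct_mult_exp oct_mult_add_left oct_mult_scaleR_left
        cos_add sin_add algebra_simps)
qed

text \<open>
  Skewness kills the mixed terms, so \<open>cos\<^sup>2 + sin\<^sup>2 = 1\<close> makes right multiplication by an exponential
  an isometry. The integrability bounds for the transform and its kernels come from this.
\<close>

lemma norm_oct_mult_exp:
  assumes "imaginary_unit e"
  shows "norm (v *\<^sub>O oct_exp e t) = norm v"
proof -
  have "cos t * (cos t * a) + sin t * (sin t * a) = a" for a
    using sin_cos_squared_add[of t] by algebra
  moreover have "v \<bullet> (v *\<^sub>O e) = 0" "(v *\<^sub>O e) \<bullet> (v *\<^sub>O e) = v \<bullet> v"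
    using assms by (simp_all add: imaginary_unit_def oct_mult_imaginary(2,3) norm_eq_1)
  ultimately have "(v *\<^sub>O oct_exp e t) \<bullet> (v *\<^sub>O oct_exp e t) = v \<bullet> v"
    by (simp add: oct_mult_exp inner_add_left inner_add_right inner_commute[of "v *\<^sub>O e" v]
        distrib_left)
  then show ?thesis by (simp add: norm_eq_sqrt_inner)
qed

text \<open>
  Averaging over the sign of the angle leaves a real factor, which can be pulled out of any bracketing.
\<close>

lemma oct_mult_exp_plus_uminus:
  "v *\<^sub>O oct_exp e t + v *\<^sub>O oct_exp e (- t) = (2 * cos t) *\<^sub>R v"
  by (simp add: oct_mult_exp scaleR_2 flip: scaleR_scaleR)

lemma continuous_on_oct_mult_exp [continuous_intros]:
  fixes f :: "'a::t2_space \<Rightarrow> octonion"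
  assumes "continuous_on S f" "continuous_on S g"
  shows "continuous_on S (\<lambda>x. f x *\<^sub>O oct_exp e (g x))"
  unfolding oct_exp_def using assms
  by (intro bounded_bilinear.continuous_on[OF bounded_bilinear_oct_mult] continuous_intros)

section \<open>Gaussians and their Fourier transforms\<close>

text \<open>
  This is the real part of the characteristic function of the standard normal distribution.
\<close>

lemma std_gaussian_cos:
  "has_bochner_integral lborel (\<lambda>s. exp (- s\<^sup>2 / 2) * cos (t * s)) (sqrt (2 * pi) * exp (- t\<^sup>2 / 2))"
proof -
  have int: "integrable lborel (\<lambda>s. std_normal_density s *\<^sub>R iexp (t * s))"
    by (rule Bochner_Integration.integrable_bound[OF integrable_normal_density[where \<mu> = 0 and \<sigma> = 1]])
       (auto simp: norm_mult)
  have "(LINT s|lborel. std_normal_density s *\<^sub>R iexp (t * s)) = char std_normal_distribution t"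
    unfolding char_def by (subst integral_density) auto
  then have "has_bochner_integral lborel (\<lambda>s. std_normal_density s *\<^sub>R iexp (t * s))
      (complex_of_real (exp (- t\<^sup>2 / 2)))"
    using int by (simp add: has_bochner_integral_iff char_std_normal_distribution)
  from has_bochner_integral_bounded_linear[OF bounded_linear_Re this]
  have "has_bochner_integral lborel (\<lambda>s. std_normal_density s * cos (t * s)) (exp (- t\<^sup>2 / 2))"
    by (simp add: Re_exp)
  from has_bochner_integral_mult_right[OF this, of "sqrt (2 * pi)"]
  show ?thesis by (simp add: std_normal_density_def)
qed

lemma gaussian_cos:
  assumes "n > 0"
  shows "has_bochner_integral lborel (\<lambda>s. exp (- pi * s\<^sup>2 / n\<^sup>2) * cos (2 * pi * s * z))
    (n * exp (- pi * (n * z)\<^sup>2))"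
proof -
  \<comment> \<open>the substitution turning the exponent \<open>pi s\<^sup>2 / n\<^sup>2\<close> into \<open>s\<^sup>2 / 2\<close>\<close>
  define c where "c = n / sqrt (2 * pi)"
  have c: "c > 0" "c\<^sup>2 = n\<^sup>2 / (2 * pi)"
    using assms by (simp_all add: c_def power_divide)
  have e: "exp (- pi * (0 + c * s)\<^sup>2 / n\<^sup>2) * cos (2 * pi * (0 + c * s) * z)
      = exp (- s\<^sup>2 / 2) * cos ((2 * pi * c * z) * s)" for s
    using assms by (simp add: power_mult_distrib c(2) mult_ac)
  have "(2 * pi * c * z)\<^sup>2 / 2 = pi * (n * z)\<^sup>2"
    by (simp add: power_mult_distrib c(2)) (simp add: power2_eq_square)
  moreover have "c * sqrt (2 * pi) = n" by (simp add: c_def)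
  ultimately have v: "n * exp (- pi * (n * z)\<^sup>2) = \<bar>c\<bar> * (sqrt (2 * pi) * exp (- (2 * pi * c * z)\<^sup>2 / 2))"
    using c(1) by (simp add: mult.assoc[symmetric])
  have "has_bochner_integral lborel (\<lambda>s. exp (- pi * (0 + c * s)\<^sup>2 / n\<^sup>2) * cos (2 * pi * (0 + c * s) * z))
     (sqrt (2 * pi) * exp (- (2 * pi * c * z)\<^sup>2 / 2))"
    unfolding e by (rule std_gaussian_cos)
  then show ?thesis
    using c(1) v lborel_has_bochner_integral_real_affine_iff[of c
      "\<lambda>s. exp (- pi * s\<^sup>2 / n\<^sup>2) * cos (2 * pi * s * z)" _ 0]
    by (simp add: mult.assoc[symmetric])
qed

text \<open>
  Lebesgue measure on a Euclidean space is the image of a product measure, so a product of functions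
  of the separate coordinates integrates factor by factor.
\<close>

lemma has_bochner_integral_lborel_prod:
  fixes g :: "'a::euclidean_space \<Rightarrow> real \<Rightarrow> real"
  assumes "\<And>b. b \<in> Basis \<Longrightarrow> has_bochner_integral lborel (g b) (I b)"
  shows "has_bochner_integral lborel (\<lambda>x. \<Prod>b\<in>Basis. g b (x \<bullet> b)) (\<Prod>b\<in>Basis. I b)"
proof -
  interpret P: product_sigma_finite "\<lambda>b::'a. lborel :: real measure"
    by standard
  have [measurable]: "g b \<in> borel_measurable borel" if "b \<in> Basis" for b
    using assms[OF that] by (auto simp: has_bochner_integral_iff dest: borel_measurable_integrable)
  have e: "(\<Prod>b\<in>Basis. g b ((\<Sum>c\<in>Basis. f c *\<^sub>R c) \<bullet> b)) = (\<Prod>b\<in>Basis. g b (f b))" for f :: "'a \<Rightarrow> real"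
    by (intro prod.cong) auto
  have "has_bochner_integral (\<Pi>\<^sub>M b\<in>Basis. lborel) (\<lambda>f. \<Prod>b\<in>Basis. g b (f b)) (\<Prod>b\<in>Basis. I b)"
    using assms P.product_integrable_prod[of Basis g] P.product_integral_prod[of Basis g]
    by (auto simp: has_bochner_integral_iff intro!: prod.cong)
  then have "has_bochner_integral (distr (\<Pi>\<^sub>M b\<in>Basis. lborel) borel (\<lambda>f. \<Sum>b\<in>Basis. f b *\<^sub>R b))
      (\<lambda>x. \<Prod>b\<in>Basis. g b (x \<bullet> b)) (\<Prod>b\<in>Basis. I b)"
    by (intro has_bochner_integral_distr) (simp_all add: e)
  then show ?thesis by (simp add: lborel_eq[symmetric])
qed

text \<open>
  The scaling is chosen so that \<open>gauss n\<close> tends to 1 as \<open>n\<close> grows while its Fourier transform, up to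
  the factor \<open>n\<close> to the dimension, is \<open>gauss (1 / n)\<close>, which concentrates at the origin.
\<close>

definition gauss :: "real \<Rightarrow> 'a::euclidean_space \<Rightarrow> real" where
  "gauss n x = exp (- pi * (norm x)\<^sup>2 / n\<^sup>2)"

lemma gauss_eq_prod: "gauss n x = (\<Prod>b\<in>Basis. exp (- pi * (x \<bullet> b)\<^sup>2 / n\<^sup>2))"
proof -
  have "(norm x)\<^sup>2 = (\<Sum>b\<in>Basis. (x \<bullet> b)\<^sup>2)"
    by (subst power2_norm_eq_inner, subst euclidean_inner) (simp add: power2_eq_square)
  then show ?thesis
    by (simp add: gauss_def exp_sum[symmetric] sum_distrib_left sum_divide_distrib sum_negf)
qed

lemma gauss_fourier:
  fixes z :: "'a::euclidean_space"
  assumes "n > 0"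
  shows "has_bochner_integral lborel
    (\<lambda>f. gauss n f * (\<Prod>b\<in>Basis. cos (2 * pi * (f \<bullet> b) * (z \<bullet> b))))
    (n ^ DIM('a) * gauss (1 / n) z)"
  using has_bochner_integral_lborel_prod[OF gaussian_cos[OF assms], of "\<lambda>b::'a. z \<bullet> b"] assms
  by (simp add: gauss_eq_prod prod.distrib power_mult_distrib field_simps)

lemma gauss_integral: "n > 0 \<Longrightarrow> has_bochner_integral lborel (gauss n :: 'a::euclidean_space \<Rightarrow> real) (n ^ DIM('a))"
  using gauss_fourier[of n "0::'a"] by (simp add: gauss_def[of _ 0])

lemma gauss_pos: "0 < gauss n x" by (simp add: gauss_def)

lemma continuous_on_gauss [continuous_intros]: "continuous_on S (gauss n)"
  unfolding gauss_def divide_inverse by (intro continuous_intros)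

lemma integrable_gauss_scaleR:
  fixes H :: "'a::euclidean_space \<Rightarrow> 'b::{banach, second_countable_topology}"
  assumes "n > 0" "continuous_on UNIV H" "\<And>f. norm (H f) \<le> B"
  shows "integrable lborel (\<lambda>f. gauss n f *\<^sub>R H f)"
proof (rule Bochner_Integration.integrable_bound)
  show "integrable lborel (\<lambda>f :: 'a. B * gauss n f)"
    using gauss_integral[OF assms(1), where 'a = 'a] by (simp add: has_bochner_integral_iff)
  have "continuous_on UNIV (\<lambda>f. gauss n f *\<^sub>R H f)"
    by (intro continuous_intros assms)
  then show "(\<lambda>f. gauss n f *\<^sub>R H f) \<in> borel_measurable lborel"
    by (simp add: borel_measurable_continuous_onI)
  have "norm (gauss n f *\<^sub>R H f) \<le> norm (B * gauss n f)" for f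
  proof -
    have "norm (gauss n f *\<^sub>R H f) \<le> gauss n f * B"
      using assms(3)[of f] gauss_pos[of n f] by simp
    also have "\<dots> \<le> norm (B * gauss n f)" by (simp add: mult.commute)
    finally show ?thesis .
  qed
  then show "AE f in lborel. norm (gauss n f *\<^sub>R H f) \<le> norm (B * gauss n f)" by simp
qed

section \<open>Recovering a continuous integrable function by Gaussian convolution\<close>

text \<open>
  The function \<open>u\<close> may be unbounded, so dominated convergence does not apply directly to the rescaled
  integral. Near \<open>x\<close>, where \<open>u\<close> is bounded by compactness, the substitution \<open>y = x + z / n\<close> makes it
  applicable; away from \<open>x\<close> the kernel tends to zero uniformly and \<open>u\<close> is integrable.
\<close>

lemma gauss_approximate_identity:
  fixes u :: "'a::euclidean_space \<Rightarrow> 'b::{banach, second_countable_topology}"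
  assumes cont: "continuous_on UNIV u" and int: "integrable lborel u"
  shows "(\<lambda>n. LINT y|lborel. (real (Suc n) ^ DIM('a) * gauss (1 / real (Suc n)) (x - y)) *\<^sub>R u y)
    \<longlonglongrightarrow> u x"
proof -
  define K where "K n y = real (Suc n) ^ DIM('a) * gauss (1 / real (Suc n)) (x - y)" for n y
  define v where "v y = indicator (ball x 1) y *\<^sub>R u y" for y
  define w where "w y = indicator (- ball x 1) y *\<^sub>R u y" for y
  have [measurable]: "u \<in> borel_measurable borel"
    using cont by (rule borel_measurable_continuous_onI)
  have [measurable]: "v \<in> borel_measurable borel" "w \<in> borel_measurable borel"
    unfolding v_def w_def by (intro borel_measurable_scaleR borel_measurable_indicator; simp)+
  have contK: "continuous_on UNIV (K n)" for n
    unfolding K_def by (intro continuous_intros continuous_on_compose2[OF continuous_on_gauss[of UNIV]]) auto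
  have [measurable]: "K n \<in> borel_measurable borel" for n
    using contK by (rule borel_measurable_continuous_onI)
  have K: "0 \<le> K n y" "K n y \<le> real (Suc n) ^ DIM('a)" for n y
    by (auto simp: K_def gauss_def intro!: mult_left_le)
  have intv: "integrable lborel v" and intw: "integrable lborel w"
    unfolding v_def w_def using int by (auto intro: integrable_mult_indicator)
  have intK: "integrable lborel (\<lambda>y. K n y *\<^sub>R h y)" if "integrable lborel h" for n and h :: "'a \<Rightarrow> 'b"
  proof (rule Bochner_Integration.integrable_bound)
    show "integrable lborel (\<lambda>y. real (Suc n) ^ DIM('a) *\<^sub>R h y)" using that by simp
    show "(\<lambda>y. K n y *\<^sub>R h y) \<in> borel_measurable lborel" using that by measurable
    show "AE y in lborel. norm (K n y *\<^sub>R h y) \<le> norm (real (Suc n) ^ DIM('a) *\<^sub>R h y)"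
      using K[of n] by (auto intro!: mult_right_mono)
  qed
  have near_far: "(LINT y|lborel. K n y *\<^sub>R u y)
      = (LINT y|lborel. K n y *\<^sub>R v y) + (LINT y|lborel. K n y *\<^sub>R w y)" for n
    by (subst Bochner_Integration.integral_add[symmetric, OF intK[OF intv] intK[OF intw]])
       (auto simp: v_def w_def indicator_def intro!: Bochner_Integration.integral_cong)
  have near: "(\<lambda>n. LINT y|lborel. K n y *\<^sub>R v y) \<longlonglongrightarrow> u x"
  proof -
    have "compact (u ` cball x 1)"
      by (intro compact_continuous_image continuous_on_subset[OF cont]) auto
    then obtain B where B: "\<And>y. y \<in> cball x 1 \<Longrightarrow> norm (u y) \<le> B"
      using compact_imp_bounded[of "u ` cball x 1"] by (metis bounded_iff imageI)
    have "0 \<le> B" using norm_ge_zero B[of x] by (rule order_trans) simp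
    with B have vB: "norm (v y) \<le> B" for y
      by (auto simp: v_def indicator_def)
    have substitution: "(LINT y|lborel. K n y *\<^sub>R v y)
        = (LINT z|lborel. gauss 1 z *\<^sub>R v (x + (1 / real (Suc n)) *\<^sub>R z))" for n
    proof -
      define c where "c = 1 / real (Suc n)"
      have c: "c > 0" "real (Suc n) = 1 / c" by (auto simp: c_def)
      have "(LINT y|lborel. K n y *\<^sub>R v y)
          = (LINT y|density (distr lborel borel (\<lambda>z. x + c *\<^sub>R z)) (\<lambda>_. \<bar>c\<bar> ^ DIM('a)). K n y *\<^sub>R v y)"
        using c(1) by (subst lborel_affine[of c x]) auto
      also have "\<dots> = (LINT z|lborel. \<bar>c\<bar> ^ DIM('a) *\<^sub>R (K n (x + c *\<^sub>R z) *\<^sub>R v (x + c *\<^sub>R z)))"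
        by (subst integral_density) (auto simp: integral_distr)
      also have "\<dots> = (LINT z|lborel. gauss 1 z *\<^sub>R v (x + c *\<^sub>R z))"
      proof (rule Bochner_Integration.integral_cong)
        fix z :: 'a
        have "K n (x + c *\<^sub>R z) = (1 / c) ^ DIM('a) * gauss 1 z"
          unfolding K_def c(2) using c(1) by (simp add: gauss_def power_mult_distrib)
        then show "\<bar>c\<bar> ^ DIM('a) *\<^sub>R (K n (x + c *\<^sub>R z) *\<^sub>R v (x + c *\<^sub>R z))
            = gauss 1 z *\<^sub>R v (x + c *\<^sub>R z)"
          using c(1) by (simp add: power_divide)
      qed simp
      finally show ?thesis by (simp add: c_def)
    qed
    have "(\<lambda>n. LINT z|lborel. gauss 1 z *\<^sub>R v (x + (1 / real (Suc n)) *\<^sub>R z))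
        \<longlonglongrightarrow> (LINT z|lborel. gauss 1 (z::'a) *\<^sub>R u x)"
    proof (rule integral_dominated_convergence)
      show "integrable lborel (\<lambda>z. B * gauss 1 (z::'a))"
        using gauss_integral[of 1, where 'a = 'a] by (simp add: has_bochner_integral_iff)
      have [measurable]: "(gauss 1 :: 'a \<Rightarrow> real) \<in> borel_measurable borel"
        by (intro borel_measurable_continuous_onI continuous_intros)
      show "(\<lambda>z. gauss 1 (z::'a) *\<^sub>R u x) \<in> borel_measurable lborel" by measurable
      show "(\<lambda>z. gauss 1 z *\<^sub>R v (x + (1 / real (Suc n)) *\<^sub>R z)) \<in> borel_measurable lborel" for n
        by measurable
      show "AE z in lborel. norm (gauss 1 z *\<^sub>R v (x + (1 / real (Suc n)) *\<^sub>R z)) \<le> B * gauss 1 z" for n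
        using vB gauss_pos[where 'a = 'a, of 1] by (auto simp: mult.commute less_imp_le intro!: mult_right_mono)
      have "\<forall>\<^sub>F y in nhds x. v y = u y"
        using eventually_nhds_in_open[of "ball x 1" x] by (auto simp: v_def elim!: eventually_mono)
      then have cont_v: "isCont v x"
        using cont by (subst isCont_cong) (auto simp: continuous_on_eq_continuous_at)
      have "v x = u x" by (simp add: v_def)
      have limit_arg: "(\<lambda>n. x + (1 / real (Suc n)) *\<^sub>R z) \<longlonglongrightarrow> x" for z
      proof -
        have "(\<lambda>n. x + (1 / real (Suc n)) *\<^sub>R z) \<longlonglongrightarrow> x + 0 *\<^sub>R z"
          using LIMSEQ_inverse_real_of_nat by (intro tendsto_intros) (simp add: inverse_eq_divide)
        then show ?thesis by simp
      qed
      have "(\<lambda>n. gauss 1 z *\<^sub>R v (x + (1 / real (Suc n)) *\<^sub>R z)) \<longlonglongrightarrow> gauss 1 z *\<^sub>R v x" for z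
        by (intro tendsto_scaleR tendsto_const isCont_tendsto_compose[OF cont_v limit_arg])
      then show "AE z in lborel. (\<lambda>n. gauss 1 z *\<^sub>R v (x + (1 / real (Suc n)) *\<^sub>R z))
          \<longlonglongrightarrow> gauss 1 z *\<^sub>R u x"
        by (simp only: \<open>v x = u x\<close> AE_I2)
    qed
    moreover have "(LINT z|lborel. gauss 1 (z::'a) *\<^sub>R u x) = u x"
      using gauss_integral[of 1, where 'a = 'a] by (simp add: has_bochner_integral_iff)
    ultimately show ?thesis by (simp add: substitution)
  qed
  have far: "(\<lambda>n. LINT y|lborel. K n y *\<^sub>R w y) \<longlonglongrightarrow> 0"
  proof (rule Lim_null_comparison)
    have "norm (LINT y|lborel. K n y *\<^sub>R w y) \<le> real (Suc n) ^ DIM('a) / exp (real (Suc n)) * (LINT y|lborel. norm (u y))" for n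
    proof -
      let ?N = "real (Suc n)"
      have "norm (K n y *\<^sub>R w y) \<le> ?N ^ DIM('a) / exp ?N * norm (u y)" for y
      proof (cases "y \<in> ball x 1")
        case False
        then have "1 \<le> (norm (x - y))\<^sup>2" by (simp add: dist_norm one_le_power)
        \<comment> \<open>the Gaussian decay in \<open>n\<close> is weakened to \<open>exp (- n)\<close>, which still beats the power of \<open>n\<close>\<close>
        moreover have "?N \<le> pi * ?N\<^sup>2"
          using pi_ge_two by (simp add: power2_eq_square) (smt (verit) mult_le_cancel_right1 mult_mono of_nat_0_le_iff)
        ultimately have "?N \<le> pi * ?N\<^sup>2 * (norm (x - y))\<^sup>2"
          by (smt (verit) mult_le_cancel_left1 of_nat_0_le_iff)
        then have "gauss (1 / ?N) (x - y) \<le> exp (- ?N)"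
          by (simp add: gauss_def power_divide mult_ac del: of_nat_Suc)
        then have "K n y \<le> ?N ^ DIM('a) / exp ?N"
          by (simp add: K_def exp_minus divide_inverse mult_left_mono del: of_nat_Suc)
        from mult_right_mono[OF this norm_ge_zero, of "u y"] show ?thesis
          using K(1)[of n y] False by (simp add: w_def del: of_nat_Suc)
      qed (simp add: w_def)
      then show ?thesis
        using int Bochner_Integration.integral_norm_bound_integral[OF intK[OF intw, of n],
            of "\<lambda>y. ?N ^ DIM('a) / exp ?N * norm (u y)"]
        by (simp del: of_nat_Suc)
    qed
    then show "\<forall>\<^sub>F n in sequentially. norm (LINT y|lborel. K n y *\<^sub>R w y)
        \<le> real (Suc n) ^ DIM('a) / exp (real (Suc n)) * (LINT y|lborel. norm (u y))" by simp
    have "(\<lambda>n. real (Suc n) ^ DIM('a) / exp (real (Suc n))) \<longlonglongrightarrow> 0"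
      by (rule filterlim_compose[OF tendsto_power_div_exp_0])
         (intro filterlim_compose[OF filterlim_real_sequentially filterlim_Suc])
    from tendsto_mult_left_zero[OF this]
    show "(\<lambda>n. real (Suc n) ^ DIM('a) / exp (real (Suc n)) * (LINT y|lborel. norm (u y))) \<longlonglongrightarrow> 0" .
  qed
  show ?thesis
    using tendsto_add[OF near far] by (simp add: K_def[symmetric] near_far del: of_nat_Suc)
qed

section \<open>Reflecting one coordinate\<close>

definition reflect :: "'n::finite \<Rightarrow> real ^ 'n \<Rightarrow> real ^ 'n" where
  "reflect k f = (\<chi> i. if i = k then - f $ i else f $ i)"

lemma reflect_nth [simp]: "reflect k f $ i = (if i = k then - f $ i else f $ i)"
  by (simp add: reflect_def)

lemma norm_reflect [simp]: "norm (reflect k f) = norm f"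
  by (auto simp: norm_vec_def intro!: L2_set_cong)

lemma gauss_reflect [simp]: "gauss n (reflect k f) = gauss n f"
  by (simp add: gauss_def)

lemma distr_reflect:
  fixes k :: "'n::finite"
  shows "distr lborel borel (reflect k) = lborel"
proof -
  define c :: "real ^ 'n \<Rightarrow> real" where "c j = (if j = axis k 1 then - 1 else 1)" for j
  have "0 + (\<Sum>j\<in>Basis. (c j * (f \<bullet> j)) *\<^sub>R j) = reflect k f" for f
  proof (rule euclidean_eqI)
    fix b :: "real ^ 'n" assume b: "b \<in> Basis"
    then obtain i where i: "b = axis i 1" by (auto simp: Basis_vec_def)
    have "(0 + (\<Sum>j\<in>Basis. (c j * (f \<bullet> j)) *\<^sub>R j)) \<bullet> b = c b * (f \<bullet> b)"
      using b by (simp only: add_0 inner_sum_left_Basis)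
    then show "(0 + (\<Sum>j\<in>Basis. (c j * (f \<bullet> j)) *\<^sub>R j)) \<bullet> b = reflect k f \<bullet> b"
      by (simp add: i c_def axis_eq_axis inner_axis)
  qed
  moreover have "(\<Prod>j\<in>Basis. \<bar>c j\<bar>) = 1"
    by (intro prod.neutral) (auto simp: c_def)
  ultimately show ?thesis
    using lborel_affine_euclidean[of c 0] by (simp add: c_def density_1)
qed

text \<open>
  Lebesgue measure is invariant under the reflection, so an integrand may be replaced by its average
  over it. This removes the terms that are odd in one frequency.
\<close>

lemma integral_reflect_average:
  fixes F H :: "real ^ 'n \<Rightarrow> 'b::{banach, second_countable_topology}"
  assumes int: "integrable lborel F" and avg: "\<And>f. F f + F (reflect k f) = 2 *\<^sub>R H f"
  shows "integral\<^sup>L lborel F = integral\<^sup>L lborel H"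
proof -
  have [measurable]: "reflect k \<in> borel_measurable borel"
  proof (intro borel_measurable_continuous_onI)
    have "continuous_on UNIV (\<lambda>f :: real ^ 'n. if i = k then - f $ i else f $ i)" for i
      by (cases "i = k") (auto intro!: continuous_intros)
    then show "continuous_on UNIV (reflect k)"
      unfolding reflect_def[abs_def] by (intro continuous_on_vec_lambda)
  qed
  have "integrable lborel (\<lambda>f. F (reflect k f))"
    using int by (subst (asm) distr_reflect[of k, symmetric]) (auto intro: integrable_distr[rotated])
  moreover have "(LINT f|lborel. F (reflect k f)) = integral\<^sup>L lborel F"
    using int by (subst (2) distr_reflect[of k, symmetric], subst integral_distr) auto
  ultimately have "2 *\<^sub>R integral\<^sup>L lborel F = (LINT f|lborel. F f + F (reflect k f))"
    using int by (simp add: scaleR_2)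
  then show ?thesis by (simp add: avg)
qed

section \<open>The inversion formula\<close>

text \<open>
  The composed kernel acts on \<open>v\<close> from the inside out. The two \<open>e\<^sub>4\<close>-exponentials merge into one
  with angle proportional to the third frequency; as the Gaussian is even
  in that frequency and the other factors are independent of it, averaging replaces the exponential by the real number \<open>cos\<close>. Now the
  \<open>e\<^sub>2\<close>-exponentials are adjacent, and the same step applies to them and then to the
  \<open>e\<^sub>1\<close>-exponentials. What remains is a product of cosines, whose integral against the Gaussian is
  its classical Fourier transform.
\<close>

lemma gauss_kernel:
  fixes x y :: "real ^ 3"
  assumes "n > 0"
  shows "(LINT f::real ^ 3|lborel. gauss n f *\<^sub>R (v
      *\<^sub>O oct_exp oct_e1 (- (2 * pi * f $ 1 * y $ 1))
      *\<^sub>O oct_exp oct_e2 (- (2 * pi * f $ 2 * y $ 2))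
      *\<^sub>O oct_exp oct_e4 (- (2 * pi * f $ 3 * y $ 3))
      *\<^sub>O oct_exp oct_e4 (2 * pi * f $ 3 * x $ 3)
      *\<^sub>O oct_exp oct_e2 (2 * pi * f $ 2 * x $ 2)
      *\<^sub>O oct_exp oct_e1 (2 * pi * f $ 1 * x $ 1)))
    = (n ^ 3 * gauss (1 / n) (x - y)) *\<^sub>R v"
    (is "integral\<^sup>L lborel ?F = _")
proof -
  define s where "s k f = 2 * pi * f $ k * (x - y) $ k" for k and f :: "real ^ 3"
  note [simp] = norm_oct_mult_exp oct_mult_scaleR_left
  \<comment> \<open>the octonion left after the \<open>e\<^sub>4\<close>-factors have become the scalar \<open>cos (s 3 f)\<close>, and after the
    \<open>e\<^sub>2\<close>-factors too; in both, the newly adjacent exponentials are already merged\<close>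
  define H2 where "H2 f = v *\<^sub>O oct_exp oct_e1 (- (2 * pi * f $ 1 * y $ 1)) *\<^sub>O oct_exp oct_e2 (s 2 f)
      *\<^sub>O oct_exp oct_e1 (2 * pi * f $ 1 * x $ 1)" for f :: "real ^ 3"
  define H1 where "H1 f = v *\<^sub>O oct_exp oct_e1 (s 1 f)" for f :: "real ^ 3"
  have s_reflect: "s k (reflect k f) = - s k f" "k \<noteq> l \<Longrightarrow> s l (reflect k f) = s l f" for k l f
    by (simp_all add: s_def)
  have cont_s [continuous_intros]: "continuous_on UNIV (s k)" for k
    unfolding s_def by (intro continuous_intros)
  have merge: "2 * pi * f $ k * x $ k - 2 * pi * f $ k * y $ k = s k f" for f k
    by (simp add: s_def algebra_simps)
  have F: "?F = (\<lambda>f. gauss n f *\<^sub>R (v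
      *\<^sub>O oct_exp oct_e1 (- (2 * pi * f $ 1 * y $ 1))
      *\<^sub>O oct_exp oct_e2 (- (2 * pi * f $ 2 * y $ 2))
      *\<^sub>O oct_exp oct_e4 (s 3 f)
      *\<^sub>O oct_exp oct_e2 (2 * pi * f $ 2 * x $ 2)
      *\<^sub>O oct_exp oct_e1 (2 * pi * f $ 1 * x $ 1)))"
    by (simp add: oct_mult_exp_exp merge)
  have cosp: "\<bar>cos a\<bar> * b \<le> b" if "b \<ge> 0" for a b :: real
    using that by (simp add: mult_left_le_one_le)
  have "integral\<^sup>L lborel ?F = (LINT f|lborel. gauss n f *\<^sub>R (cos (s 3 f) *\<^sub>R H2 f))"
    unfolding F
  proof (rule integral_reflect_average[where k = 3], goal_cases)
    case 1
    show ?case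
      by (rule integrable_gauss_scaleR[OF assms, where B = "norm v"]) (auto intro!: continuous_intros)
  next
    case (2 f)
    have p: "a *\<^sub>O oct_exp oct_e4 (s 3 f) *\<^sub>O b *\<^sub>O c + a *\<^sub>O oct_exp oct_e4 (- s 3 f) *\<^sub>O b *\<^sub>O c
      = (2 * cos (s 3 f)) *\<^sub>R (a *\<^sub>O b *\<^sub>O c)" for a b c
      by (simp add: oct_mult_exp_plus_uminus flip: oct_mult_add_left)
    show ?case
      by (simp add: s_reflect p H2_def oct_mult_exp_exp merge mult.left_commute[of _ 2] flip: scaleR_add_right)
  qed
  also have "\<dots> = (LINT f|lborel. gauss n f *\<^sub>R ((cos (s 3 f) * cos (s 2 f)) *\<^sub>R H1 f))"
  proof (rule integral_reflect_average[where k = 2], goal_cases)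
    case 1
    show ?case
      by (rule integrable_gauss_scaleR[OF assms, where B = "norm v"])
         (auto simp: H2_def intro!: continuous_intros cosp)
  next
    case (2 f)
    have p: "a *\<^sub>O oct_exp oct_e2 (s 2 f) *\<^sub>O b + a *\<^sub>O oct_exp oct_e2 (- s 2 f) *\<^sub>O b
      = (2 * cos (s 2 f)) *\<^sub>R (a *\<^sub>O b)" for a b
      by (simp add: oct_mult_exp_plus_uminus flip: oct_mult_add_left)
    show ?case
      by (simp add: s_reflect p H2_def H1_def oct_mult_exp_exp merge mult.left_commute[of _ 2] flip: scaleR_add_right)
  qed
  also have "\<dots> = (LINT f|lborel. gauss n f *\<^sub>R ((cos (s 3 f) * cos (s 2 f) * cos (s 1 f)) *\<^sub>R v))"
  proof (rule integral_reflect_average[where k = 1], goal_cases)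
    case 1
    show ?case
      by (rule integrable_gauss_scaleR[OF assms, where B = "norm v"])
         (auto simp: H1_def abs_mult mult.assoc intro!: continuous_intros order_trans[OF cosp] cosp)
  next
    case (2 f)
    show ?case
      by (simp add: s_reflect H1_def oct_mult_exp_plus_uminus mult.left_commute[of _ 2] flip: scaleR_add_right)
  qed
  also have "\<dots> = (LINT f|lborel. (gauss n f * (\<Prod>b\<in>Basis. cos (2 * pi * (f \<bullet> b) * ((x - y) \<bullet> b)))) *\<^sub>R v)"
  proof -
    have "(\<Prod>b\<in>Basis. cos (2 * pi * (f \<bullet> b) * ((x - y) \<bullet> b))) = (\<Prod>k\<in>UNIV. cos (s k f))" for f
    proof -
      have basis: "(Basis :: (real ^ 3) set) = range (\<lambda>k. axis k 1)"
        by (auto simp: Basis_vec_def)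
      have "inj (\<lambda>k :: 3. axis k (1 :: real))"
        by (simp add: inj_def axis_eq_axis)
      then show ?thesis
        unfolding basis by (simp add: prod.reindex s_def inner_axis)
    qed
    moreover have "(\<Prod>k\<in>UNIV. cos (s k f)) = cos (s 3 f) * cos (s 2 f) * cos (s 1 f)" for f
      unfolding UNIV_3 by (simp add: mult_ac)
    ultimately show ?thesis by (simp only: scaleR_scaleR)
  qed
  also have "\<dots> = (n ^ 3 * gauss (1 / n) (x - y)) *\<^sub>R v"
    using gauss_fourier[OF assms, of "x - y"] by (simp add: has_bochner_integral_iff)
  finally show ?thesis .
qed

theorem theorem1:
  fixes u :: "real ^ 3 \<Rightarrow> octonion" and x :: "real ^ 3"
  assumes "continuous_on UNIV u"
    and "integrable lebesgue u"
    and "integrable lebesgue (OFT u)"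
  shows "u x = (LINT f|lebesgue. OFT u f
     *\<^sub>O oct_exp oct_e4 (2 * pi * f $ 3 * x $ 3)
     *\<^sub>O oct_exp oct_e2 (2 * pi * f $ 2 * x $ 2)
     *\<^sub>O oct_exp oct_e1 (2 * pi * f $ 1 * x $ 1))"
proof -
  define T where "T f y = u y
      *\<^sub>O oct_exp oct_e1 (- (2 * pi * f $ 1 * y $ 1))
      *\<^sub>O oct_exp oct_e2 (- (2 * pi * f $ 2 * y $ 2))
      *\<^sub>O oct_exp oct_e4 (- (2 * pi * f $ 3 * y $ 3))" for f y :: "real ^ 3"
  define S where "S f w = w
      *\<^sub>O oct_exp oct_e4 (2 * pi * f $ 3 * x $ 3)
      *\<^sub>O oct_exp oct_e2 (2 * pi * f $ 2 * x $ 2)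
      *\<^sub>O oct_exp oct_e1 (2 * pi * f $ 1 * x $ 1)" for f :: "real ^ 3" and w
  note [simp] = norm_oct_mult_exp
  have norm_T: "norm (T f y) = norm (u y)" and norm_S: "norm (S f w) = norm w" for f y w
    by (simp_all add: T_def S_def)
  have lin_S: "bounded_linear (S f)" for f
  proof -
    have "bounded_linear (\<lambda>w. w *\<^sub>O a *\<^sub>O b *\<^sub>O c)" for a b c
      by (intro bounded_linear_intros
          bounded_linear_compose[OF bounded_bilinear.bounded_linear_left[OF bounded_bilinear_oct_mult]])
    then show ?thesis by (simp add: S_def[abs_def])
  qed
  have [measurable]: "u \<in> borel_measurable borel"
    using assms(1) by (rule borel_measurable_continuous_onI)
  have int_u: "integrable lborel u"
    using assms(2) by (simp add: integrable_completion)
  have cont_T: "continuous_on UNIV (\<lambda>(f, y). T f y)"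
    unfolding T_def case_prod_beta
    by (intro continuous_intros continuous_on_compose2[OF assms(1)]) auto
  have meas_T: "(\<lambda>(f, y). T f y) \<in> borel_measurable (lborel \<Otimes>\<^sub>M lborel)"
    using borel_measurable_continuous_onI[OF cont_T] by (simp add: lborel_prod)
  have OFT: "OFT u f = (LINT y|lborel. T f y)" for f
  proof -
    have "continuous_on UNIV (T f)"
      unfolding T_def by (intro continuous_intros assms(1))
    then have "T f \<in> borel_measurable lborel"
      by (simp add: borel_measurable_continuous_onI)
    from integral_completion[OF this] show ?thesis
      by (simp add: OFT_def T_def[abs_def])
  qed
  have meas_OFT [measurable]: "OFT u \<in> borel_measurable borel"
  proof -
    have "(\<lambda>f. LINT y|lborel. T f y) \<in> borel_measurable lborel"
      by (rule lborel.borel_measurable_lebesgue_integral[OF meas_T])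
    then show ?thesis by (simp add: OFT[abs_def])
  qed
  have int_OFT: "integrable lborel (OFT u)"
    using assms(3) by (simp add: integrable_completion)
  have cont_S: "continuous_on UNIV (\<lambda>p. S (fst p) (snd p))"
    unfolding S_def by (intro continuous_intros)
  have meas_S: "(\<lambda>f. S f (OFT u f)) \<in> borel_measurable lborel"
    using borel_measurable_continuous_Pair[OF _ _ cont_S, of "\<lambda>f. f" lborel "OFT u"] by simp

  \<comment> \<open>the inversion integral with a Gaussian factor that makes the double integral over \<open>f\<close> and \<open>y\<close>
    absolutely convergent\<close>
  define I where "I n = (LINT f|lborel. gauss (real (Suc n)) f *\<^sub>R S f (OFT u f))" for n
  have I_lim: "I \<longlonglongrightarrow> (LINT f|lborel. S f (OFT u f))"
    unfolding I_def[abs_def]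
  proof (rule integral_dominated_convergence)
    show "integrable lborel (\<lambda>f. norm (OFT u f))"
      using int_OFT by simp
    have [measurable]: "gauss n \<in> borel_measurable (borel :: (real ^ 3) measure)" for n
      by (intro borel_measurable_continuous_onI continuous_intros)
    show "(\<lambda>f. gauss (real (Suc n)) f *\<^sub>R S f (OFT u f)) \<in> borel_measurable lborel" for n
      using meas_S by (intro borel_measurable_scaleR) auto
    show "AE f in lborel. norm (gauss (real (Suc n)) f *\<^sub>R S f (OFT u f)) \<le> norm (OFT u f)" for n
      by (simp add: norm_S gauss_def mult_left_le_one_le)
    have "(\<lambda>n. gauss (real (Suc n)) f *\<^sub>R S f (OFT u f)) \<longlonglongrightarrow> S f (OFT u f)" for f
    proof -
      have "(\<lambda>n. exp (- pi * (norm f)\<^sup>2 * (1 / real (Suc n))\<^sup>2) *\<^sub>R S f (OFT u f))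
          \<longlonglongrightarrow> exp (- pi * (norm f)\<^sup>2 * 0\<^sup>2) *\<^sub>R S f (OFT u f)"
        using LIMSEQ_inverse_real_of_nat by (intro tendsto_intros) (simp add: inverse_eq_divide)
      then show ?thesis by (simp add: gauss_def power_divide)
    qed
    then show "AE f in lborel. (\<lambda>n. gauss (real (Suc n)) f *\<^sub>R S f (OFT u f))
        \<longlonglongrightarrow> S f (OFT u f)" by simp
  qed (use meas_S in simp)

  have I_eq: "I n = (LINT y|lborel. (real (Suc n) ^ DIM(real ^ 3) * gauss (1 / real (Suc n)) (x - y)) *\<^sub>R u y)"
    for n
  proof -
    let ?G = "gauss (real (Suc n)) :: real ^ 3 \<Rightarrow> real"
    have int: "integrable (lborel \<Otimes>\<^sub>M lborel) (\<lambda>(f, y). ?G f *\<^sub>R S f (T f y))"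
    proof (rule lborel_pair.Fubini_integrable)
      have "continuous_on UNIV (\<lambda>(f, y). ?G f *\<^sub>R S f (T f y))"
        unfolding T_def S_def case_prod_beta
        by (intro continuous_intros continuous_on_compose2[OF assms(1)]
            continuous_on_compose2[OF continuous_on_gauss[of UNIV]]) auto
      then show "(\<lambda>(f, y). ?G f *\<^sub>R S f (T f y)) \<in> borel_measurable (lborel \<Otimes>\<^sub>M lborel)"
        by (simp add: lborel_prod borel_measurable_continuous_onI)
      have n: "norm (?G f *\<^sub>R S f (T f y)) = ?G f * norm (u y)" for f y
        using gauss_pos[of _ f] by (simp add: norm_S norm_T less_imp_le)
      show "integrable lborel (\<lambda>f. LINT y|lborel. norm (case (f, y) of (f, y) \<Rightarrow> ?G f *\<^sub>R S f (T f y)))"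
        unfolding case_prod_conv n
        using gauss_integral[of "real (Suc n)", where 'a = "real ^ 3"] by (simp add: has_bochner_integral_iff)
      have "integrable lborel (\<lambda>y. ?G f *\<^sub>R S f (T f y))" for f
      proof (rule Bochner_Integration.integrable_bound)
        show "integrable lborel (\<lambda>y. ?G f * norm (u y))" using int_u by simp
        have "continuous_on UNIV (\<lambda>y. ?G f *\<^sub>R S f (T f y))"
          unfolding T_def S_def by (intro continuous_intros assms(1))
        then show "(\<lambda>y. ?G f *\<^sub>R S f (T f y)) \<in> borel_measurable lborel"
          by (simp add: borel_measurable_continuous_onI)
        show "AE y in lborel. norm (?G f *\<^sub>R S f (T f y)) \<le> norm (?G f * norm (u y))"
          unfolding n by simp
      qed
      then show "AE f in lborel. integrable lborel (\<lambda>y. case (f, y) of (f, y) \<Rightarrow> ?G f *\<^sub>R S f (T f y))"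
        by simp
    qed
    have int_T: "integrable lborel (T f)" for f
    proof (rule Bochner_Integration.integrable_bound[OF int_u])
      show "T f \<in> borel_measurable lborel"
        using measurable_compose[OF measurable_Pair1' meas_T, of f] by simp
    qed (simp add: norm_T)
    have "I n = (LINT f|lborel. LINT y|lborel. ?G f *\<^sub>R S f (T f y))"
      by (simp add: I_def OFT integral_bounded_linear[OF lin_S int_T])
    also have "\<dots> = (LINT y|lborel. LINT f|lborel. ?G f *\<^sub>R S f (T f y))"
      by (rule lborel_pair.Fubini_integral[OF int, symmetric])
    also have "\<dots> = (LINT y|lborel. (real (Suc n) ^ 3 * gauss (1 / real (Suc n)) (x - y)) *\<^sub>R u y)"
      unfolding S_def T_def by (subst gauss_kernel) simp_all
    finally show ?thesis by simp
  qed
  have "I \<longlonglongrightarrow> u x"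
    unfolding I_eq[abs_def] by (rule gauss_approximate_identity[OF assms(1) int_u])
  then have "u x = (LINT f|lborel. S f (OFT u f))"
    using I_lim by (rule LIMSEQ_unique)
  also have "\<dots> = (LINT f|lebesgue. S f (OFT u f))"
    by (rule integral_completion[OF meas_S, symmetric])
  finally show ?thesis
    by (simp add: S_def)
qed

end
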